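(* Let $\mathcal{L}_1,\mathcal{L}_2\in\mathrm{Mat}_d(\mathbb{Z})$ be irreducible and coprime with $|\det\mathcal{L}_1|=p$, $|\det\mathcal{L}_2|=q$. Let $\Lambda=\mathbb{Z}^d\cap \mathcal{L}_1^{-1}\mathcal{L}_2 \mathbb{Z}^d\cap \mathcal{L}_2^{-1}\mathcal{L}_1 \mathbb{Z}^d$ and $\Gamma_1=\Lambda\cap \mathcal{L}_2^{-1}\mathcal{L}_1\Lambda$. Then $\mathcal{L}_1$ and $\mathcal{L}_2$ induce well-defined group homomorphisms $$\phi_1,\phi_2:\mathbb{Z}^d/\Gamma_1\to \mathbb{Z}^d/\mathcal{L}_1\Lambda,\qquad \phi_i(x+\Gamma_1)=\mathcal{L}_ix+\mathcal{L}_1\Lambda,$$ of finite abelian groups, and $\phi_1+\phi_2$ is an isomorphism. (In particular $\Gamma_1$ has index $p^2q$ in $\mathbb{Z}^d$.)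
   Context: Irreducible: there are no non-trivial subspaces $U,V$ of $\mathbb{Q}^d$ of the same dimension with $\mathcal{L}_1U\subseteq V$ and $\mathcal{L}_2U\subseteq V$. Coprime: there are no $\mathcal{P},\mathcal{Q}\in \mathrm{GL}_d(\mathbb{Q})$ with $0<|\det(\mathcal{P})\det(\mathcal{Q})|<1$ such that $\mathcal{P}\mathcal{L}_1\mathcal{Q},\mathcal{P}\mathcal{L}_2\mathcal{Q}\in\mathrm{Mat}_d(\mathbb{Z})$. Under these hypotheses $\Lambda$ is a lattice of index $pq$ in $\mathbb{Z}^d$. *)

theory Defs
  imports "HOL-Analysis.Analysis"
begin

text \<open>Vectors in Q^d / Z^d are \<open>rat ^ 'n\<close> / \<open>int ^ 'n\<close>, d = CARD('n).\<close>

definition qscale :: "rat \<Rightarrow> rat ^ 'n \<Rightarrow> rat ^ 'n" where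
  "qscale c x = (\<chi> i. c * x $ i)"

lemma vector_space_qscale: "vector_space qscale"
  by unfold_locales (auto simp: qscale_def vec_eq_iff algebra_simps)

text \<open>Q-linear subspaces of Q^d and their dimension.\<close>
abbreviation qsubspace :: "(rat ^ 'n) set \<Rightarrow> bool" where
  "qsubspace U \<equiv> module.subspace qscale U"

abbreviation qdim :: "(rat ^ 'n) set \<Rightarrow> nat" where
  "qdim U \<equiv> vector_space.dim qscale U"

definition to_rat_mat :: "int ^ 'n ^ 'n \<Rightarrow> rat ^ 'n ^ 'n" where
  "to_rat_mat L = (\<chi> i j. of_int (L $ i $ j))"

definition irreducible_pair :: "int ^ 'n ^ 'n \<Rightarrow> int ^ 'n ^ 'n \<Rightarrow> bool" where
  "irreducible_pair L1 L2 \<longleftrightarrow>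
     \<not> (\<exists>U V :: (rat ^ 'n) set.
          qsubspace U \<and> qsubspace V \<and>
          U \<noteq> {0} \<and> U \<noteq> UNIV \<and> V \<noteq> {0} \<and> V \<noteq> UNIV \<and>
          qdim U = qdim V \<and>
          (\<lambda>x. to_rat_mat L1 *v x) ` U \<subseteq> V \<and>
          (\<lambda>x. to_rat_mat L2 *v x) ` U \<subseteq> V)"

definition int_matrix :: "rat ^ 'n ^ 'n \<Rightarrow> bool" where
  "int_matrix M \<longleftrightarrow> (\<forall>i j. M $ i $ j \<in> \<int>)"

definition coprime_pair :: "int ^ 'n ^ 'n \<Rightarrow> int ^ 'n ^ 'n \<Rightarrow> bool" where
  "coprime_pair L1 L2 \<longleftrightarrow>
     \<not> (\<exists>P Q :: rat ^ 'n ^ 'n.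
          invertible P \<and> invertible Q \<and>
          0 < \<bar>det P * det Q\<bar> \<and> \<bar>det P * det Q\<bar> < 1 \<and>
          int_matrix (P ** to_rat_mat L1 ** Q) \<and>
          int_matrix (P ** to_rat_mat L2 ** Q))"

text \<open>\<open>Lambda = Z^d \<inter> L1^{-1} L2 Z^d \<inter> L2^{-1} L1 Z^d\<close>; for invertible L1, L2,
  \<open>x \<in> L1^{-1} L2 Z^d\<close> iff \<open>L1 x \<in> L2 Z^d\<close>.\<close>
definition Lam :: "int ^ 'n ^ 'n \<Rightarrow> int ^ 'n ^ 'n \<Rightarrow> (int ^ 'n) set" where
  "Lam L1 L2 = {x. (\<exists>y. L1 *v x = L2 *v y) \<and> (\<exists>y. L2 *v x = L1 *v y)}"

text \<open>\<open>Gamma1 = Lambda \<inter> L2^{-1} L1 Lambda\<close>.\<close>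
definition Gamma1 :: "int ^ 'n ^ 'n \<Rightarrow> int ^ 'n ^ 'n \<Rightarrow> (int ^ 'n) set" where
  "Gamma1 L1 L2 = {x \<in> Lam L1 L2. \<exists>y \<in> Lam L1 L2. L2 *v x = L1 *v y}"

text \<open>The set of cosets \<open>Z^d / G\<close> of a subgroup \<open>G\<close> of \<open>Z^d\<close>.\<close>
definition cosets :: "(int ^ 'n) set \<Rightarrow> (int ^ 'n) set set" where
  "cosets G = {(\<lambda>g. x + g) ` G | x. True}"

end

theory Submission
  imports Defs
begin

text \<open>Write \<open>[\<int>\<^sup>d : X]\<close> for the index of a full lattice \<open>X\<close>; it is the determinant of
  a basis, which we obtain in Hermite normal form. Everything rests on one consequence of
  coprimality: if \<open>L\<^sub>1\<close> and \<open>L\<^sub>2\<close> both map a full lattice \<open>X\<close> into a full lattice \<open>Y\<close>, then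
  \<open>[\<int>\<^sup>d : Y] \<le> [\<int>\<^sup>d : X]\<close>. For \<open>X = \<int>\<^sup>d\<close> this gives \<open>L\<^sub>1\<int>\<^sup>d + L\<^sub>2\<int>\<^sup>d = \<int>\<^sup>d\<close>, so by the Chinese
  remainder theorem \<open>L\<^sub>1\<int>\<^sup>d \<inter> L\<^sub>2\<int>\<^sup>d\<close> has index \<open>pq\<close>. The map
  \<open>x \<mapsto> (L\<^sub>1x mod L\<^sub>2\<int>\<^sup>d, L\<^sub>2x mod L\<^sub>1\<int>\<^sup>d)\<close> has kernel \<open>\<Lambda>\<close>, so \<open>[\<int>\<^sup>d : \<Lambda>] \<le> pq\<close>, and
  coprimality with \<open>X = \<Lambda>\<close>, \<open>Y = L\<^sub>1\<int>\<^sup>d \<inter> L\<^sub>2\<int>\<^sup>d\<close> gives equality; hence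
  \<open>[\<int>\<^sup>d : L\<^sub>1\<Lambda>] = p\<^sup>2q\<close>. Finally \<open>L\<^sub>1 + L\<^sub>2\<close> has kernel exactly \<open>\<Gamma>\<^sub>1\<close> modulo \<open>L\<^sub>1\<Lambda>\<close>, so
  \<open>\<phi>\<^sub>1 + \<phi>\<^sub>2\<close> embeds \<open>\<int>\<^sup>d/\<Gamma>\<^sub>1\<close> into \<open>\<int>\<^sup>d/L\<^sub>1\<Lambda>\<close>, and coprimality with \<open>X = \<Gamma>\<^sub>1\<close>, \<open>Y = L\<^sub>1\<Lambda>\<close>
  makes the embedding onto.\<close>

section \<open>Cosets of subgroups of \<open>\<int>\<^sup>d\<close>\<close>

text \<open>Subgroups of \<open>\<int>\<^sup>d\<close> are its \<open>\<int>\<close>-submodules, so \<open>int_vec.subspace\<close> serves as the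
  subgroup predicate.\<close>

interpretation int_vec: module "(*s) :: int \<Rightarrow> int ^ 'n \<Rightarrow> int ^ 'n"
  by unfold_locales (auto simp: vec_eq_iff algebra_simps)

context module
begin

lemma translate_eq_iff_diff_in_subspace:
  assumes "subspace H"
  shows "(+) x ` H = (+) y ` H \<longleftrightarrow> x - y \<in> H"
proof
  assume "(+) x ` H = (+) y ` H"
  moreover have "x \<in> (+) x ` H"
    using subspace_0[OF assms] by force
  ultimately obtain h where "h \<in> H" "x = y + h" by auto
  then show "x - y \<in> H" by simp
next
  assume xy: "x - y \<in> H"
  have "(+) x ` H = (+) y ` (+) (x - y) ` H"
    by (simp add: image_image algebra_simps)
  also have "(+) (x - y) ` H = H"
  proof
    show "(+) (x - y) ` H \<subseteq> H"
      using subspace_add[OF assms xy] by auto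
    show "H \<subseteq> (+) (x - y) ` H"
    proof
      fix h assume "h \<in> H"
      then have "h - (x - y) \<in> H" using subspace_diff[OF assms _ xy] by blast
      then show "h \<in> (+) (x - y) ` H" by (force intro: image_eqI[of _ _ "h - (x - y)"])
    qed
  qed
  finally show "(+) x ` H = (+) y ` H" .
qed

end

lemma bij_betw_ranges_same_fibres:
  assumes "\<And>x y. f x = f y \<longleftrightarrow> g x = g y"
  shows "bij_betw (\<lambda>c. g (SOME x. f x = c)) (range f) (range g)"
proof -
  have g_some: "g (SOME x. f x = f y) = g y" for y
    using someI[of "\<lambda>x. f x = f y" y] assms by blast
  show ?thesis
  proof (rule bij_betwI')
    fix a b assume "a \<in> range f" "b \<in> range f"
    then show "(g (SOME x. f x = a) = g (SOME x. f x = b)) = (a = b)"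
      using g_some assms by auto
  next
    show "g (SOME x. f x = a) \<in> range g" for a by simp
    show "\<exists>a \<in> range f. c = g (SOME x. f x = a)" if "c \<in> range g" for c
      using that g_some by (metis rangeE rangeI)
  qed
qed

lemma cosets_eq_range: "cosets H = range (\<lambda>x. (+) x ` H)"
  by (auto simp: cosets_def)

lemma
  assumes "int_vec.subspace H" and "\<And>x y. f x = f y \<longleftrightarrow> x - y \<in> H"
  shows card_cosets_eq_card_range: "card (cosets H) = card (range f)"
    and finite_cosets_iff_finite_range: "finite (cosets H) \<longleftrightarrow> finite (range f)"
proof -
  have "bij_betw (\<lambda>c. f (SOME x. (+) x ` H = c)) (cosets H) (range f)"
    unfolding cosets_eq_range
    by (rule bij_betw_ranges_same_fibres)
       (simp add: int_vec.translate_eq_iff_diff_in_subspace[OF assms(1)] assms(2))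
  then show "card (cosets H) = card (range f)" "finite (cosets H) \<longleftrightarrow> finite (range f)"
    using bij_betw_same_card bij_betw_finite by blast+
qed

lemma card_cosets_le_card_image:
  assumes "int_vec.subspace H" "\<And>x y. f x = f y \<longleftrightarrow> x - y \<in> H" "range f \<subseteq> S" "finite S"
  shows "card (cosets H) \<le> card S"
  using card_cosets_eq_card_range[OF assms(1,2)] card_mono[OF assms(4,3)] by simp

lemma cosets_UNIV: "cosets (UNIV :: (int ^ 'n) set) = {UNIV}"
proof -
  have "(+) x ` UNIV = (UNIV :: (int ^ 'n) set)" for x :: "int ^ 'n"
    by (rule surjI[of _ "\<lambda>y. y - x"]) simp
  then show ?thesis by (auto simp: cosets_def)
qed

lemma subspace_eq_UNIV_if_card_cosets_le_1:
  assumes "int_vec.subspace H" "finite (cosets H)" "card (cosets H) \<le> 1"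
  shows "H = UNIV"
proof -
  have "\<forall>c \<in> cosets H. \<forall>c' \<in> cosets H. c = c'"
    using assms(2,3) card_le_Suc0_iff_eq by (metis One_nat_def)
  then have "(+) x ` H = (+) 0 ` H" for x
    unfolding cosets_def by blast
  then have "x - 0 \<in> H" for x
    using int_vec.translate_eq_iff_diff_in_subspace[OF assms(1)] by blast
  then show ?thesis by auto
qed

lemma surj_mod_if_card_cosets_le:
  assumes "int_vec.subspace X" "int_vec.subspace Y" "finite (cosets Y)"
    and "\<And>x y. f x - f y \<in> Y \<longleftrightarrow> x - y \<in> X" "card (cosets Y) \<le> card (cosets X)"
  shows "finite (cosets X)" "card (cosets X) = card (cosets Y)" "\<exists>x. z - f x \<in> Y"
proof -
  let ?F = "\<lambda>x. (+) (f x) ` Y"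
  have F: "?F x = ?F y \<longleftrightarrow> x - y \<in> X" for x y
    using int_vec.translate_eq_iff_diff_in_subspace[OF assms(2)] assms(4) by simp
  have "range ?F \<subseteq> cosets Y"
    by (auto simp: cosets_def)
  moreover have "card (range ?F) = card (cosets X)"
    using card_cosets_eq_card_range[OF assms(1) F] by simp
  ultimately have "range ?F = cosets Y"
    using assms(3,5) by (metis card_seteq)
  then show "finite (cosets X)" "card (cosets X) = card (cosets Y)"
    using assms(3) finite_cosets_iff_finite_range[OF assms(1) F] \<open>card (range ?F) = _\<close> by simp_all
  from \<open>range ?F = cosets Y\<close> obtain x where "?F x = (+) z ` Y"
    by (metis (mono_tags, lifting) cosets_def imageE mem_Collect_eq)
  then have "- (f x - z) \<in> Y"
    using int_vec.translate_eq_iff_diff_in_subspace[OF assms(2)] int_vec.subspace_neg[OF assms(2)]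
    by blast
  then show "\<exists>x. z - f x \<in> Y" by auto
qed

section \<open>Integer matrices\<close>

lemma matrix_vector_mult_scale: "(A :: 'a::comm_ring_1 ^ 'n ^ 'm) *v (c *s x) = c *s (A *v x)"
  by (simp add: matrix_vector_mult_def vec_eq_iff sum_distrib_left mult_ac)

lemma matrix_vector_mult_axis_nth: "(A *v axis j 1) $ i = A $ i $ j"
  by (simp add: matrix_vector_mult_def axis_def if_distrib cong: if_cong)

lemma det_upperdiagonal_wrt:
  fixes A :: "'a::comm_ring_1 ^ 'n ^ 'n" and ix :: "'n \<Rightarrow> nat"
  assumes "inj ix" and "\<And>i j. ix j < ix i \<Longrightarrow> A $ i $ j = 0"
  shows "det A = (\<Prod>i\<in>UNIV. A $ i $ i)"
proof -
  have "(\<Prod>i\<in>UNIV. A $ i $ p i) = 0" if p: "p permutes UNIV" "p \<noteq> id" for p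
  proof -
    have "\<exists>i. ix (p i) < ix i"
    proof (rule ccontr)
      assume "\<not> ?thesis"
      then have le: "ix i \<le> ix (p i)" for i by (simp add: not_less)
      have "sum ix UNIV = sum (ix \<circ> p) UNIV" by (rule sum.permute[OF p(1)])
      then have "ix i = ix (p i)" for i by (intro sum_mono_inv[OF _ le]) auto
      with \<open>inj ix\<close> have "p i = i" for i by (metis injD)
      then have "p = id" by auto
      with p(2) show False ..
    qed
    then obtain i where "ix (p i) < ix i" ..
    then show ?thesis using assms(2) by (intro prod_zero) auto
  qed
  then have "\<forall>p \<in> {p. p permutes UNIV} - {id}. of_int (sign p) * (\<Prod>i\<in>UNIV. A $ i $ p i) = 0"
    by simp
  from sum.mono_neutral_cong_left[OF finite_permutations[OF finite_class.finite_UNIV] _ this]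
  show ?thesis
    unfolding det_def by (simp add: sign_id permutes_id)
qed

definition to_rat_vec :: "int ^ 'n \<Rightarrow> rat ^ 'n" where
  "to_rat_vec x = (\<chi> i. of_int (x $ i))"

lemma to_rat_vec_eq_iff [simp]: "to_rat_vec x = to_rat_vec y \<longleftrightarrow> x = y"
  by (simp add: to_rat_vec_def vec_eq_iff)

lemma to_rat_mat_mult_vec: "to_rat_mat A *v to_rat_vec x = to_rat_vec (A *v x)"
  by (simp add: to_rat_mat_def to_rat_vec_def matrix_vector_mult_def vec_eq_iff)

lemma to_rat_vec_scale: "to_rat_vec (c *s x) = of_int c *s to_rat_vec x"
  by (simp add: to_rat_vec_def vec_eq_iff)

lemma det_to_rat_mat: "det (to_rat_mat A) = of_int (det A)"
  by (simp add: det_def to_rat_mat_def)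

text \<open>Cramer's rule over \<open>\<rat>\<close>, with the denominator \<open>det A\<close> cleared.\<close>

lemma det_scale_in_range: "\<exists>y. (A :: int ^ 'n ^ 'n) *v y = det A *s b"
proof (cases "det A = 0")
  case True
  then show ?thesis by (intro exI[of _ 0]) (simp add: vec_eq_iff)
next
  case False
  let ?A = "to_rat_mat A" and ?b = "to_rat_vec b"
  define y where "y = (\<chi> k. det (\<chi> i j. if j = k then b $ i else A $ i $ j))"
  have d: "det ?A \<noteq> 0"
    using False by (simp add: det_to_rat_mat)
  have "(\<chi> i j. if j = k then ?b $ i else ?A $ i $ j) = to_rat_mat (\<chi> i j. if j = k then b $ i else A $ i $ j)" for k
    by (simp add: to_rat_mat_def to_rat_vec_def vec_eq_iff)
  then have "to_rat_vec y = det ?A *s (\<chi> k. det (\<chi> i j. if j = k then ?b $ i else ?A $ i $ j) / det ?A)"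
    using d by (simp add: y_def to_rat_vec_def vec_eq_iff det_to_rat_mat)
  then have "to_rat_vec (A *v y) = to_rat_vec (det A *s b)"
    using cramer[OF d, of _ ?b] d
    by (simp add: to_rat_mat_mult_vec[symmetric] vector_scalar_commute to_rat_vec_scale det_to_rat_mat)
  then show ?thesis by auto
qed

lemma abs_det_scale_in_range: "\<bar>det A\<bar> *s b \<in> range ((*v) (A :: int ^ 'n ^ 'n))"
proof -
  obtain y where y: "A *v y = det A *s b"
    using det_scale_in_range by blast
  have "A *v (sgn (det A) *s y) = \<bar>det A\<bar> *s b"
    by (simp add: matrix_vector_mult_scale y abs_sgn mult.commute)
  then show ?thesis by (metis rangeI)
qed

lemma matrix_factor_if_range_subset:
  assumes "range ((*v) A) \<subseteq> range ((*v) (B :: 'a::comm_semiring_1 ^ 'n ^ 'm))"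
  obtains U where "A = B ** U"
proof -
  have "\<forall>j. \<exists>w. B *v w = A *v axis j 1"
    using assms by (metis rangeE rangeI subsetD)
  then obtain w where w: "\<And>j. B *v w j = A *v axis j 1"
    by metis
  have "(B ** (\<chi> i j. w j $ i)) $ i $ j = (B *v w j) $ i" for i j
    by (simp add: matrix_matrix_mult_def matrix_vector_mult_def)
  then have "A = B ** (\<chi> i j. w j $ i)"
    by (simp add: vec_eq_iff w matrix_vector_mult_axis_nth)
  then show ?thesis ..
qed

lemma abs_det_eq_if_range_eq:
  fixes A B :: "int ^ 'n ^ 'n"
  assumes "range ((*v) A) = range ((*v) B)" "det B \<noteq> 0"
  shows "\<bar>det A\<bar> = \<bar>det B\<bar>"
proof -
  obtain U where U: "A = B ** U"
    using assms(1) by (rule matrix_factor_if_range_subset[OF equalityD1])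
  obtain V where V: "B = A ** V"
    using assms(1) by (rule matrix_factor_if_range_subset[OF equalityD2])
  have "det B * (det U * det V) = det B"
    using U V by (metis det_mul matrix_mul_assoc mult.assoc)
  then have "\<bar>det U\<bar> = 1"
    using assms(2) zmult_eq_1_iff by (metis abs_1 abs_neg_one mult_cancel_left1)
  then show ?thesis
    using U by (simp add: det_mul abs_mult)
qed

lemma int_vec_subspace_range: "int_vec.subspace (range ((*v) (M :: int ^ 'n ^ 'm)))"
proof -
  have "0 \<in> range ((*v) M)"
    by (metis matrix_vector_mult_0_right rangeI)
  moreover have "u + v \<in> range ((*v) M)" if "u \<in> range ((*v) M)" "v \<in> range ((*v) M)" for u v
    using that by (auto simp flip: matrix_vector_right_distrib)
  moreover have "c *s u \<in> range ((*v) M)" if "u \<in> range ((*v) M)" for c u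
    using that by (auto simp flip: matrix_vector_mult_scale)
  ultimately show ?thesis
    unfolding int_vec.subspace_def by blast
qed

lemma int_vec_subspace_vimage:
  "int_vec.subspace K \<Longrightarrow> int_vec.subspace ((*v) (A :: int ^ 'n ^ 'm) -` K)"
  by (simp add: int_vec.subspace_def matrix_vector_right_distrib matrix_vector_mult_scale)

section \<open>Full lattices and their Hermite normal form\<close>

definition full_lattice :: "(int ^ 'n) set \<Rightarrow> bool" where
  "full_lattice H \<longleftrightarrow> int_vec.subspace H \<and> (\<exists>N > 0. \<forall>x. N *s x \<in> H)"

lemma full_lattice_range: "det A \<noteq> 0 \<Longrightarrow> full_lattice (range ((*v) (A :: int ^ 'n ^ 'n)))"
  using int_vec_subspace_range abs_det_scale_in_range unfolding full_lattice_def
  by (metis zero_less_abs_iff)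

lemma full_lattice_vimage:
  assumes "full_lattice K"
  shows "full_lattice ((*v) (A :: int ^ 'n ^ 'm) -` K)"
proof -
  obtain N where "N > 0" "\<And>x. N *s x \<in> K" "int_vec.subspace K"
    using assms by (auto simp: full_lattice_def)
  then show ?thesis
    unfolding full_lattice_def
    by (intro conjI int_vec_subspace_vimage exI[of _ N]) (auto simp: matrix_vector_mult_scale)
qed

lemma full_lattice_UNIV: "full_lattice UNIV"
  by (auto simp: full_lattice_def intro: exI[of _ 1])

lemma full_lattice_Int:
  assumes "full_lattice H" "full_lattice K"
  shows "full_lattice (H \<inter> K)"
proof -
  obtain M N where "M > 0" "N > 0" "\<And>x. M *s x \<in> H" "\<And>x. N *s x \<in> K"
    and "int_vec.subspace H" "int_vec.subspace K"
    using assms by (auto simp: full_lattice_def)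
  then have "(M * N) *s x \<in> H \<inter> K" for x
    using int_vec.subspace_scale by (metis IntI mult.commute vector_smult_assoc)
  then show ?thesis
    using \<open>M > 0\<close> \<open>N > 0\<close> int_vec.subspace_inter[OF \<open>int_vec.subspace H\<close> \<open>int_vec.subspace K\<close>]
    by (auto simp: full_lattice_def intro!: exI[of _ "M * N"])
qed

lemma card_vec_box:
  assumes "\<And>j. finite (S j)"
  shows "finite {x :: 'a ^ 'n. \<forall>j. x $ j \<in> S j}"
    and "card {x :: 'a ^ 'n. \<forall>j. x $ j \<in> S j} = (\<Prod>j\<in>UNIV. card (S j))"
proof -
  have bij: "bij_betw vec_nth {x :: 'a ^ 'n. \<forall>j. x $ j \<in> S j} (PiE UNIV S)"
  proof (rule bij_betw_imageI)
    show "inj_on vec_nth {x :: 'a ^ 'n. \<forall>j. x $ j \<in> S j}" by (auto simp: inj_on_def vec_eq_iff)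
    show "vec_nth ` {x :: 'a ^ 'n. \<forall>j. x $ j \<in> S j} = PiE UNIV S"
    proof
      show "PiE UNIV S \<subseteq> vec_nth ` {x :: 'a ^ 'n. \<forall>j. x $ j \<in> S j}"
        by (rule subsetI, rule image_eqI[where x = "vec_lambda _"]) (auto simp: PiE_def)
    qed (auto simp: PiE_def)
  qed
  show "finite {x :: 'a ^ 'n. \<forall>j. x $ j \<in> S j}"
    using bij_betw_finite[OF bij] assms by (simp add: finite_PiE)
  show "card {x :: 'a ^ 'n. \<forall>j. x $ j \<in> S j} = (\<Prod>j\<in>UNIV. card (S j))"
    using bij_betw_same_card[OF bij] by (simp add: card_PiE)
qed

text \<open>With the coordinates ordered by \<open>ix\<close>, the \<open>k\<close>-th basis vector of \<open>H\<close> is supported on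
  the first \<open>k + 1\<close> coordinates and has the least positive \<open>k\<close>-th entry possible there: the
  columns of a Hermite normal form.\<close>

locale echelon_basis =
  fixes H :: "(int ^ 'n) set" and N :: int and ix :: "'n \<Rightarrow> nat"
  assumes subspace_H: "int_vec.subspace H"
    and N_pos: "N > 0" and N_scale_in: "\<And>x. N *s x \<in> H"
    and bij_ix: "bij_betw ix UNIV {..<CARD('n)}"
begin

definition coord :: "nat \<Rightarrow> 'n" where
  "coord k = inv_into UNIV ix k"

definition supported :: "nat \<Rightarrow> (int ^ 'n) set" where
  "supported k = {x. \<forall>j. k \<le> ix j \<longrightarrow> x $ j = 0}"

definition pivot :: "nat \<Rightarrow> nat" where
  "pivot k = (LEAST t. t > 0 \<and> (\<exists>x \<in> H \<inter> supported (Suc k). x $ coord k = int t))"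

definition pivot_vec :: "nat \<Rightarrow> int ^ 'n" where
  "pivot_vec k = (SOME x. x \<in> H \<inter> supported (Suc k) \<and> x $ coord k = int (pivot k))"

definition basis :: "int ^ 'n ^ 'n" where
  "basis = (\<chi> i j. pivot_vec (ix j) $ i)"

definition box :: "(int ^ 'n) set" where
  "box = {x. \<forall>j. x $ j \<in> {0..<int (pivot (ix j))}}"

lemma inj_ix: "inj ix"
  using bij_ix by (simp add: bij_betw_def)

lemma ix_less: "ix j < CARD('n)"
  using bij_ix by (auto simp: bij_betw_def)

lemma coord_ix [simp]: "coord (ix j) = j"
  by (simp add: coord_def inj_ix)

lemma ix_coord [simp]: "k < CARD('n) \<Longrightarrow> ix (coord k) = k"
  unfolding coord_def using bij_ix by (simp add: bij_betw_def f_inv_into_f)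

lemma subspace_supported: "int_vec.subspace (supported k)"
  by (auto simp: int_vec.subspace_def supported_def)

lemma supported_0: "supported 0 = {0}"
  by (auto simp: supported_def vec_eq_iff)

lemma supported_CARD: "supported CARD('n) = UNIV"
  using ix_less by (auto simp: supported_def not_le[symmetric])

lemma supported_Suc_mono: "supported k \<subseteq> supported (Suc k)"
  by (auto simp: supported_def)

lemma axis_supported: "k < CARD('n) \<Longrightarrow> axis (coord k) c \<in> supported (Suc k)"
  by (auto simp: supported_def axis_def)

lemma supported_SucD:
  assumes "k < CARD('n)" "x \<in> supported (Suc k)" "x $ coord k = 0"
  shows "x \<in> supported k"
  unfolding supported_def
proof (intro CollectI allI impI)
  fix j assume "k \<le> ix j"
  then consider "j = coord k" | "Suc k \<le> ix j"
    by (metis coord_ix le_antisym not_less_eq_eq)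
  then show "x $ j = 0"
    using assms(2,3) by cases (auto simp: supported_def)
qed

lemma pivot_spec:
  assumes "k < CARD('n)"
  shows "pivot k > 0" and "\<exists>x \<in> H \<inter> supported (Suc k). x $ coord k = int (pivot k)"
proof -
  have "N *s axis (coord k) 1 \<in> H \<inter> supported (Suc k)"
    using N_scale_in int_vec.subspace_scale[OF subspace_supported axis_supported[OF assms]]
    by blast
  moreover have "(N *s axis (coord k) 1) $ coord k = int (nat N)"
    using N_pos by simp
  ultimately have "\<exists>t. t > 0 \<and> (\<exists>x \<in> H \<inter> supported (Suc k). x $ coord k = int t)"
    using N_pos by (intro exI[of _ "nat N"] conjI bexI) auto
  from LeastI_ex[OF this, folded pivot_def]
  show "pivot k > 0" and "\<exists>x \<in> H \<inter> supported (Suc k). x $ coord k = int (pivot k)"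
    by auto
qed

lemma pivot_le:
  "t > 0 \<Longrightarrow> x \<in> H \<Longrightarrow> x \<in> supported (Suc k) \<Longrightarrow> x $ coord k = int t \<Longrightarrow> pivot k \<le> t"
  unfolding pivot_def by (rule Least_le) blast

lemma pivot_vec_spec:
  assumes "k < CARD('n)"
  shows "pivot_vec k \<in> H" "pivot_vec k \<in> supported (Suc k)"
    and "pivot_vec k $ coord k = int (pivot k)"
  using someI_ex[OF pivot_spec(2)[OF assms, unfolded Bex_def], folded pivot_vec_def] by auto

lemma reduce_by_pivot_vec:
  assumes "k < CARD('n)" "x \<in> supported (Suc k)"
  shows "x - (x $ coord k div int (pivot k)) *s pivot_vec k \<in> supported (Suc k)"
    and "(x - (x $ coord k div int (pivot k)) *s pivot_vec k) $ coord k = x $ coord k mod int (pivot k)"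
  using int_vec.subspace_diff[OF subspace_supported assms(2)
      int_vec.subspace_scale[OF subspace_supported pivot_vec_spec(2)[OF assms(1)]]]
    pivot_vec_spec(3)[OF assms(1)]
  by (simp_all add: minus_div_mult_eq_mod[symmetric] mult.commute)

text \<open>The remainder left by \<open>reduce_by_pivot_vec\<close> would contradict the minimality of the
  pivot.\<close>

lemma pivot_dvd:
  assumes k: "k < CARD('n)" and x: "x \<in> H" "x \<in> supported (Suc k)"
  shows "int (pivot k) dvd x $ coord k"
proof (rule ccontr)
  let ?r = "x $ coord k mod int (pivot k)"
  assume "\<not> ?thesis"
  then have "?r > 0" "?r < int (pivot k)"
    using pivot_spec(1)[OF k] by (simp_all add: dvd_eq_mod_eq_0 order_le_neq_trans)
  moreover have "x - (x $ coord k div int (pivot k)) *s pivot_vec k \<in> H"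
    using int_vec.subspace_diff[OF subspace_H x(1) int_vec.subspace_scale[OF subspace_H pivot_vec_spec(1)[OF k]]] .
  ultimately have "pivot k \<le> nat ?r"
    using reduce_by_pivot_vec[OF k x(2)] by (intro pivot_le) auto
  with \<open>?r > 0\<close> \<open>?r < int (pivot k)\<close> show False by (simp add: le_nat_iff)
qed

lemma basis_mult_axis: "basis *v axis j 1 = pivot_vec (ix j)"
  by (simp add: basis_def matrix_vector_mult_def axis_def vec_eq_iff if_distrib cong: if_cong)

lemma range_basis: "range ((*v) basis) = H"
proof
  have "basis *v y = (\<Sum>j\<in>UNIV. y $ j *s pivot_vec (ix j))" for y
    by (simp add: basis_def matrix_vector_mult_def vec_eq_iff sum_component mult.commute)
  then show "range ((*v) basis) \<subseteq> H"
    using pivot_vec_spec(1)[OF ix_less] subspace_H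
    by (auto intro!: int_vec.subspace_sum int_vec.subspace_scale)
  have "x \<in> range ((*v) basis)" if "k \<le> CARD('n)" "x \<in> H \<inter> supported k" for k x
    using that
  proof (induction k arbitrary: x)
    case 0
    then show ?case using supported_0 by (auto intro: range_eqI[of _ _ 0])
  next
    case (Suc k)
    then have k: "k < CARD('n)" by simp
    obtain t where t: "x $ coord k = t * int (pivot k)"
      using pivot_dvd[OF k] Suc.prems(2) by (metis IntE dvdE mult.commute)
    let ?x' = "x - t *s pivot_vec k"
    have "?x' \<in> H"
      using Suc.prems(2) int_vec.subspace_diff[OF subspace_H _ int_vec.subspace_scale[OF subspace_H pivot_vec_spec(1)[OF k]]]
      by blast
    moreover have "?x' \<in> supported k"
      using Suc.prems(2) t pivot_vec_spec[OF k]
        int_vec.subspace_diff[OF subspace_supported _ int_vec.subspace_scale[OF subspace_supported]]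
      by (intro supported_SucD[OF k]) auto
    ultimately obtain y where "?x' = basis *v y"
      using Suc by auto
    then have "x = basis *v y + t *s (basis *v axis (coord k) 1)"
      by (simp add: basis_mult_axis k algebra_simps)
    also have "\<dots> = basis *v (y + t *s axis (coord k) 1)"
      by (simp add: matrix_vector_right_distrib matrix_vector_mult_scale)
    finally show ?case by blast
  qed
  then show "H \<subseteq> range ((*v) basis)"
    using supported_CARD by blast
qed

lemma zero_in_box: "0 \<in> box"
  using pivot_spec(1)[OF ix_less] by (auto simp: box_def)

lemma exists_box_representative:
  assumes "k \<le> CARD('n)" "x \<in> supported k"
  shows "\<exists>r \<in> box \<inter> supported k. x - r \<in> H"
  using assms
proof (induction k arbitrary: x)
  case 0
  then show ?case
    using zero_in_box supported_0 int_vec.subspace_0[OF subspace_H] by auto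
next
  case (Suc k)
  then have k: "k < CARD('n)" by simp
  define m where "m = x $ coord k mod int (pivot k)"
  define y where "y = x - (x $ coord k div int (pivot k)) *s pivot_vec k"
  have y: "y \<in> supported (Suc k)" "y $ coord k = m"
    using reduce_by_pivot_vec[OF k Suc.prems(2)] by (simp_all add: y_def m_def)
  have "y - m *s axis (coord k) 1 \<in> supported k"
    using y int_vec.subspace_diff[OF subspace_supported y(1)
        int_vec.subspace_scale[OF subspace_supported axis_supported[OF k]]]
    by (intro supported_SucD[OF k]) auto
  then obtain r where r: "r \<in> box" "r \<in> supported k" "y - m *s axis (coord k) 1 - r \<in> H"
    using Suc.IH k by auto
  have "m \<in> {0..<int (pivot k)}"
    using pivot_spec(1)[OF k] by (simp add: m_def)
  moreover have "r $ coord k = 0"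
    using r(2) k by (simp add: supported_def)
  ultimately have "r + m *s axis (coord k) 1 \<in> box"
    using r(1) k by (auto simp: box_def axis_def)
  moreover have "r + m *s axis (coord k) 1 \<in> supported (Suc k)"
    using supported_Suc_mono r(2) int_vec.subspace_add[OF subspace_supported _
        int_vec.subspace_scale[OF subspace_supported axis_supported[OF k]]]
    by blast
  moreover have "x - (r + m *s axis (coord k) 1)
      = (y - m *s axis (coord k) 1 - r) + (x $ coord k div int (pivot k)) *s pivot_vec k"
    by (simp add: y_def)
  then have "x - (r + m *s axis (coord k) 1) \<in> H"
    using int_vec.subspace_add[OF subspace_H r(3) int_vec.subspace_scale[OF subspace_H pivot_vec_spec(1)[OF k]]]
    by (simp only:)
  ultimately show ?case by blast
qed

lemma eq_0_if_bounded_by_pivots: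
  assumes "k \<le> CARD('n)" "d \<in> H" "d \<in> supported k" "\<And>j. \<bar>d $ j\<bar> < int (pivot (ix j))"
  shows "d = 0"
  using assms
proof (induction k)
  case 0
  then show ?case using supported_0 by simp
next
  case (Suc k)
  then have k: "k < CARD('n)" by simp
  have "int (pivot k) dvd d $ coord k"
    using pivot_dvd[OF k Suc.prems(2,3)] .
  moreover have "\<bar>d $ coord k\<bar> < int (pivot k)"
    using Suc.prems(4)[of "coord k"] k by simp
  ultimately have "d $ coord k = 0"
    using dvd_imp_le_int by force
  then have "d \<in> supported k"
    using supported_SucD[OF k Suc.prems(3)] by blast
  then show ?case
    using Suc.IH Suc.prems(2,4) k by simp
qed

lemma bij_betw_box_cosets: "bij_betw (\<lambda>r. (+) r ` H) box (cosets H)"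
proof (rule bij_betw_imageI)
  show "inj_on (\<lambda>r. (+) r ` H) box"
  proof (rule inj_onI)
    fix r r' assume "r \<in> box" "r' \<in> box" "(+) r ` H = (+) r' ` H"
    then have "r - r' \<in> H"
      using int_vec.translate_eq_iff_diff_in_subspace[OF subspace_H] by blast
    moreover have "\<bar>(r - r') $ j\<bar> < int (pivot (ix j))" for j
    proof -
      have "r $ j \<in> {0..<int (pivot (ix j))}" "r' $ j \<in> {0..<int (pivot (ix j))}"
        using \<open>r \<in> box\<close> \<open>r' \<in> box\<close> by (simp_all add: box_def)
      then show ?thesis by (auto simp: abs_less_iff)
    qed
    ultimately have "r - r' = 0"
      using eq_0_if_bounded_by_pivots[of "CARD('n)" "r - r'"] supported_CARD by blast
    then show "r = r'" by simp
  qed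
  show "(\<lambda>r. (+) r ` H) ` box = cosets H"
  proof
    show "cosets H \<subseteq> (\<lambda>r. (+) r ` H) ` box"
    proof
      fix c assume "c \<in> cosets H"
      then obtain x where "c = (+) x ` H" by (auto simp: cosets_def)
      moreover obtain r where "r \<in> box" "x - r \<in> H"
        using exists_box_representative[of "CARD('n)" x] supported_CARD by auto
      ultimately show "c \<in> (\<lambda>r. (+) r ` H) ` box"
        using int_vec.translate_eq_iff_diff_in_subspace[OF subspace_H] by auto
    qed
  qed (auto simp: cosets_def)
qed

lemma finite_cosets: "finite (cosets H)"
  and card_cosets: "card (cosets H) = (\<Prod>j\<in>UNIV. pivot (ix j))"
  using bij_betw_finite[OF bij_betw_box_cosets] bij_betw_same_card[OF bij_betw_box_cosets]
    card_vec_box[of "\<lambda>j. {0..<int (pivot (ix j))}"]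
  by (simp_all add: box_def)

lemma det_basis: "det basis = (\<Prod>j\<in>UNIV. int (pivot (ix j)))"
proof -
  have "det basis = (\<Prod>j\<in>UNIV. basis $ j $ j)"
  proof (rule det_upperdiagonal_wrt[OF inj_ix])
    fix i j assume "ix j < ix i"
    then show "basis $ i $ j = 0"
      using pivot_vec_spec(2)[OF ix_less[of j]] by (simp add: basis_def supported_def)
  qed
  then show ?thesis
    using pivot_vec_spec(3)[OF ix_less] by (simp add: basis_def)
qed

end

theorem full_lattice_basis:
  fixes H :: "(int ^ 'n) set"
  assumes "full_lattice H"
  obtains M where "range ((*v) M) = H" "finite (cosets H)" "int (card (cosets H)) = det M"
proof -
  obtain N where "N > 0" "\<And>x. N *s x \<in> H" "int_vec.subspace H"
    using assms by (auto simp: full_lattice_def)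
  moreover have "\<exists>ix :: 'n \<Rightarrow> nat. bij_betw ix UNIV {..<CARD('n)}"
    using ex_bij_betw_finite_nat[of "UNIV :: 'n set"] by (simp add: atLeast0LessThan)
  then obtain ix :: "'n \<Rightarrow> nat" where "bij_betw ix UNIV {..<CARD('n)}" ..
  ultimately interpret echelon_basis H N ix
    by unfold_locales
  show ?thesis
    by (rule that[of basis]) (simp_all add: range_basis finite_cosets card_cosets det_basis)
qed

lemma full_lattice_finite_cosets: "full_lattice H \<Longrightarrow> finite (cosets H)"
  by (erule full_lattice_basis)

lemma
  fixes A :: "int ^ 'n ^ 'n"
  assumes "det A \<noteq> 0"
  shows finite_cosets_range: "finite (cosets (range ((*v) A)))"
    and card_cosets_range: "int (card (cosets (range ((*v) A)))) = \<bar>det A\<bar>"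
proof -
  obtain B where B: "range ((*v) B) = range ((*v) A)" "finite (cosets (range ((*v) A)))"
      "int (card (cosets (range ((*v) A)))) = det B"
    by (rule full_lattice_basis[OF full_lattice_range[OF assms]])
  then show "finite (cosets (range ((*v) A)))"
    and "int (card (cosets (range ((*v) A)))) = \<bar>det A\<bar>"
    using abs_det_eq_if_range_eq[OF B(1) assms] by simp_all
qed

text \<open>If both matrices map the lattice \<open>X\<close> into \<open>Y\<close> and \<open>Y\<close> had smaller index, then with bases
  \<open>Q\<close> of \<open>X\<close> and \<open>P\<^sup>-\<^sup>1\<close> of \<open>Y\<close> the matrices \<open>P A Q\<close>, \<open>P B Q\<close> are integral while
  \<open>|det P det Q| = [\<int>\<^sup>d : X] / [\<int>\<^sup>d : Y] < 1\<close>.\<close>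

lemma card_cosets_le_if_coprime_pair:
  fixes A B :: "int ^ 'n ^ 'n"
  assumes "coprime_pair A B" "full_lattice X" "full_lattice Y"
    and "(*v) A ` X \<subseteq> Y" "(*v) B ` X \<subseteq> Y"
  shows "card (cosets Y) \<le> card (cosets X)"
proof (rule ccontr)
  assume "\<not> ?thesis"
  obtain MX where MX: "range ((*v) MX) = X" "finite (cosets X)" "int (card (cosets X)) = det MX"
    using full_lattice_basis[OF assms(2)] .
  obtain MY where MY: "range ((*v) MY) = Y" "finite (cosets Y)" "int (card (cosets Y)) = det MY"
    using full_lattice_basis[OF assms(3)] .
  have "card (cosets X) > 0"
    using MX(2) by (auto simp: cosets_def card_gt_0_iff)
  with \<open>\<not> ?thesis\<close> MX(3) MY(3) have dets: "0 < det MX" "det MX < det MY"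
    by linarith+
  let ?Q = "to_rat_mat MX"
  have "invertible (to_rat_mat MY)"
    using dets by (simp add: invertible_det_nz det_to_rat_mat)
  then obtain P where P: "to_rat_mat MY ** P = mat 1" "P ** to_rat_mat MY = mat 1"
    unfolding invertible_def by blast
  have "det P * of_int (det MY) = 1"
    using P(2) by (metis det_I det_mul det_to_rat_mat)
  then have "det P * det ?Q = of_int (det MX) / of_int (det MY)"
    using dets by (simp add: det_to_rat_mat field_simps)
  then have "0 < \<bar>det P * det ?Q\<bar>" "\<bar>det P * det ?Q\<bar> < 1"
    using dets by auto
  moreover have "invertible P"
    using P unfolding invertible_def by blast
  moreover have "invertible ?Q"
    using dets by (simp add: invertible_det_nz det_to_rat_mat)
  moreover have "int_matrix (P ** to_rat_mat C ** ?Q)" if "(*v) C ` X \<subseteq> Y" for C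
    unfolding int_matrix_def
  proof (intro allI)
    fix i j
    have "C *v (MX *v axis j 1) \<in> range ((*v) MY)"
      using that MX(1) MY(1) by blast
    then obtain w where w: "MY *v w = C *v (MX *v axis j 1)"
      by (metis rangeE)
    have "axis j 1 = to_rat_vec (axis j 1)"
      by (simp add: to_rat_vec_def axis_def vec_eq_iff)
    then have "(P ** to_rat_mat C ** ?Q) *v axis j 1 = P *v (to_rat_mat MY *v to_rat_vec w)"
      by (simp add: matrix_vector_mul_assoc[symmetric] to_rat_mat_mult_vec w)
    also have "\<dots> = to_rat_vec w"
      by (simp add: matrix_vector_mul_assoc P(2))
    finally show "(P ** to_rat_mat C ** ?Q) $ i $ j \<in> \<int>"
      by (metis matrix_vector_mult_axis_nth to_rat_vec_def vec_lambda_beta Ints_of_int)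
  qed
  ultimately show False
    using assms(1,4,5) unfolding coprime_pair_def by blast
qed

section \<open>A coprime pair of integer matrices\<close>

locale coprime_int_pair =
  fixes L1 L2 :: "int ^ 'n ^ 'n"
  assumes coprime: "coprime_pair L1 L2"
    and det_L1: "det L1 \<noteq> 0" and det_L2: "det L2 \<noteq> 0"
begin

lemma range_add_range_eq_UNIV: "\<exists>x y. z = L1 *v x + L2 *v y"
proof -
  define S where "S = int_vec.span (range ((*v) L1) \<union> range ((*v) L2))"
  have ranges: "range ((*v) L1) \<subseteq> S" "range ((*v) L2) \<subseteq> S"
    unfolding S_def by (auto intro: int_vec.span_base)
  have "int_vec.subspace S"
    by (simp add: S_def)
  moreover have "\<bar>det L1\<bar> *s x \<in> S" for x
    using abs_det_scale_in_range ranges by blast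
  ultimately have "full_lattice S"
    unfolding full_lattice_def using det_L1 by (intro conjI exI[of _ "\<bar>det L1\<bar>"]) auto
  then have "card (cosets S) \<le> card (cosets (UNIV :: (int ^ 'n) set))"
    using ranges by (intro card_cosets_le_if_coprime_pair[OF coprime full_lattice_UNIV]) auto
  then have "S = UNIV"
    using \<open>int_vec.subspace S\<close> full_lattice_finite_cosets[OF \<open>full_lattice S\<close>]
    by (intro subspace_eq_UNIV_if_card_cosets_le_1) (simp_all add: cosets_UNIV)
  then have "z \<in> {u + v | u v. u \<in> range ((*v) L1) \<and> v \<in> range ((*v) L2)}"
    unfolding S_def int_vec.span_Un
    by (simp add: int_vec.span_eq_iff[THEN iffD2, OF int_vec_subspace_range])
  then show ?thesis by blast
qed

text \<open>Chinese remainder theorem for the coprime lattices \<open>L\<^sub>1\<int>\<^sup>d\<close> and \<open>L\<^sub>2\<int>\<^sup>d\<close>.\<close>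

lemma card_cosets_range_Int:
  "int (card (cosets (range ((*v) L1) \<inter> range ((*v) L2)))) = \<bar>det L1\<bar> * \<bar>det L2\<bar>"
proof -
  let ?R1 = "range ((*v) L1)" and ?R2 = "range ((*v) L2)"
  let ?F = "\<lambda>z. ((+) z ` ?R1, (+) z ` ?R2)"
  have F: "?F z = ?F w \<longleftrightarrow> z - w \<in> ?R1 \<inter> ?R2" for z w
    using int_vec.translate_eq_iff_diff_in_subspace[OF int_vec_subspace_range[of L1]]
      int_vec.translate_eq_iff_diff_in_subspace[OF int_vec_subspace_range[of L2]] by simp
  have "range ?F = cosets ?R1 \<times> cosets ?R2"
  proof
    show "cosets ?R1 \<times> cosets ?R2 \<subseteq> range ?F"
    proof
      fix c assume "c \<in> cosets ?R1 \<times> cosets ?R2"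
      then obtain a b where c: "c = ((+) a ` ?R1, (+) b ` ?R2)"
        by (auto simp: cosets_def)
      obtain x y where "a - b = L1 *v x + L2 *v y"
        using range_add_range_eq_UNIV by blast
      have "(a - L1 *v x) - a = L1 *v (0 - x)"
        unfolding matrix_vector_mult_diff_distrib by simp
      moreover have "(a - L1 *v x) - b = L2 *v y"
        using \<open>a - b = _\<close> by (simp add: algebra_simps)
      ultimately have "(a - L1 *v x) - a \<in> ?R1" "(a - L1 *v x) - b \<in> ?R2"
        by simp_all
      then have "?F (a - L1 *v x) = c"
        using c int_vec.translate_eq_iff_diff_in_subspace[OF int_vec_subspace_range[of L1]]
          int_vec.translate_eq_iff_diff_in_subspace[OF int_vec_subspace_range[of L2]] by simp
      then show "c \<in> range ?F" by blast
    qed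
  qed (auto simp: cosets_def)
  then show ?thesis
    using card_cosets_eq_card_range[OF int_vec.subspace_inter[OF int_vec_subspace_range int_vec_subspace_range] F]
      card_cosets_range[OF det_L1] card_cosets_range[OF det_L2]
    by (simp add: card_cartesian_product)
qed

lemma Lam_eq_vimage: "Lam L1 L2 = (*v) L1 -` range ((*v) L2) \<inter> (*v) L2 -` range ((*v) L1)"
  by (auto simp: Lam_def)

lemma full_lattice_Lam: "full_lattice (Lam L1 L2)"
  unfolding Lam_eq_vimage
  using full_lattice_range det_L1 det_L2 by (intro full_lattice_Int full_lattice_vimage)

lemma subspace_Lam: "int_vec.subspace (Lam L1 L2)"
  using full_lattice_Lam by (simp add: full_lattice_def)

lemma card_cosets_Lam: "int (card (cosets (Lam L1 L2))) = \<bar>det L1\<bar> * \<bar>det L2\<bar>"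
proof -
  let ?R1 = "range ((*v) L1)" and ?R2 = "range ((*v) L2)"
  let ?G = "\<lambda>x. ((+) (L1 *v x) ` ?R2, (+) (L2 *v x) ` ?R1)"
  have G: "?G x = ?G y \<longleftrightarrow> x - y \<in> Lam L1 L2" for x y
    using int_vec.translate_eq_iff_diff_in_subspace[OF int_vec_subspace_range[of L1]]
      int_vec.translate_eq_iff_diff_in_subspace[OF int_vec_subspace_range[of L2]]
    by (simp add: Lam_eq_vimage matrix_vector_mult_diff_distrib)
  have G_range: "range ?G \<subseteq> cosets ?R2 \<times> cosets ?R1"
    by (auto simp: cosets_def)
  have fin: "finite (cosets ?R2 \<times> cosets ?R1)"
    using finite_cosets_range[OF det_L1] finite_cosets_range[OF det_L2] by blast
  have "card (cosets (Lam L1 L2)) \<le> card (cosets ?R2) * card (cosets ?R1)"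
    using card_cosets_le_card_image[OF subspace_Lam G G_range fin] by (simp add: card_cartesian_product)
  then have upper: "int (card (cosets (Lam L1 L2))) \<le> int (card (cosets ?R1)) * int (card (cosets ?R2))"
    by (simp only: mult.commute[of "card (cosets ?R2)"] of_nat_mult[symmetric] of_nat_le_iff)
  have "card (cosets (?R1 \<inter> ?R2)) \<le> card (cosets (Lam L1 L2))"
    using full_lattice_Lam full_lattice_Int[OF full_lattice_range[OF det_L1] full_lattice_range[OF det_L2]]
    by (intro card_cosets_le_if_coprime_pair[OF coprime]) (auto simp: Lam_def)
  then show ?thesis
    using upper[unfolded card_cosets_range[OF det_L1] card_cosets_range[OF det_L2]]
      card_cosets_range_Int by linarith
qed

lemma image_Lam_eq_range:
  obtains B where "(*v) L1 ` Lam L1 L2 = range ((*v) (L1 ** B))"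
    and "\<bar>det B\<bar> = \<bar>det L1\<bar> * \<bar>det L2\<bar>"
proof -
  obtain B where B: "range ((*v) B) = Lam L1 L2" "finite (cosets (Lam L1 L2))"
    "int (card (cosets (Lam L1 L2))) = det B"
    by (rule full_lattice_basis[OF full_lattice_Lam])
  have "(*v) L1 ` Lam L1 L2 = range ((*v) (L1 ** B))"
    unfolding B(1)[symmetric] by (auto simp: image_image matrix_vector_mul_assoc)
  moreover have "\<bar>det B\<bar> = \<bar>det L1\<bar> * \<bar>det L2\<bar>"
    using B(3) card_cosets_Lam by simp
  ultimately show ?thesis ..
qed

lemma
  shows full_lattice_image_Lam: "full_lattice ((*v) L1 ` Lam L1 L2)"
    and finite_cosets_image_Lam: "finite (cosets ((*v) L1 ` Lam L1 L2))"
    and card_cosets_image_Lam: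
      "int (card (cosets ((*v) L1 ` Lam L1 L2))) = \<bar>det L1\<bar> ^ 2 * \<bar>det L2\<bar>"
proof -
  obtain B where B: "(*v) L1 ` Lam L1 L2 = range ((*v) (L1 ** B))"
    "\<bar>det B\<bar> = \<bar>det L1\<bar> * \<bar>det L2\<bar>"
    by (rule image_Lam_eq_range)
  then have d: "det (L1 ** B) \<noteq> 0"
    using det_L1 det_L2 by (auto simp: det_mul)
  show "full_lattice ((*v) L1 ` Lam L1 L2)"
    and "finite (cosets ((*v) L1 ` Lam L1 L2))"
    and "int (card (cosets ((*v) L1 ` Lam L1 L2))) = \<bar>det L1\<bar> ^ 2 * \<bar>det L2\<bar>"
    unfolding B(1)
    using full_lattice_range[OF d] finite_cosets_range[OF d] card_cosets_range[OF d] B(2)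
    by (simp_all add: det_mul abs_mult power2_eq_square)
qed

lemma Gamma1_eq: "Gamma1 L1 L2 = Lam L1 L2 \<inter> (*v) L2 -` ((*v) L1 ` Lam L1 L2)"
  by (auto simp: Gamma1_def)

lemma Gamma1_maps_to_image_Lam:
  assumes "z \<in> Gamma1 L1 L2"
  shows "L1 *v z \<in> (*v) L1 ` Lam L1 L2" "L2 *v z \<in> (*v) L1 ` Lam L1 L2"
  using assms by (auto simp: Gamma1_eq)

text \<open>The kernel of \<open>\<phi>\<^sub>1 + \<phi>\<^sub>2\<close>: if \<open>L\<^sub>1z + L\<^sub>2z = L\<^sub>1l\<close> with \<open>l \<in> \<Lambda>\<close>, then \<open>L\<^sub>2z = L\<^sub>1(l - z)\<close>
  and \<open>L\<^sub>1z = L\<^sub>2(w - z)\<close> for \<open>L\<^sub>1l = L\<^sub>2w\<close>, which puts \<open>z\<close> in \<open>\<Lambda>\<close> and then in \<open>\<Gamma>\<^sub>1\<close>.\<close>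

lemma add_in_image_Lam_iff:
  "L1 *v z + L2 *v z \<in> (*v) L1 ` Lam L1 L2 \<longleftrightarrow> z \<in> Gamma1 L1 L2"
proof
  assume "L1 *v z + L2 *v z \<in> (*v) L1 ` Lam L1 L2"
  then obtain l where l: "l \<in> Lam L1 L2" "L1 *v z + L2 *v z = L1 *v l"
    by auto
  then obtain w where "L1 *v l = L2 *v w"
    by (auto simp: Lam_def)
  then have "L1 *v z = L2 *v (w - z)" "L2 *v z = L1 *v (l - z)"
    using l(2) by (simp_all add: matrix_vector_mult_diff_distrib algebra_simps)
  then have "z \<in> Lam L1 L2"
    by (auto simp: Lam_def)
  with \<open>L2 *v z = L1 *v (l - z)\<close> show "z \<in> Gamma1 L1 L2"
    using int_vec.subspace_diff[OF subspace_Lam l(1)] by (auto simp: Gamma1_def)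
next
  assume "z \<in> Gamma1 L1 L2"
  then obtain y where "z \<in> Lam L1 L2" "y \<in> Lam L1 L2" "L2 *v z = L1 *v y"
    by (auto simp: Gamma1_def)
  then show "L1 *v z + L2 *v z \<in> (*v) L1 ` Lam L1 L2"
    using int_vec.subspace_add[OF subspace_Lam]
    by (auto simp: matrix_vector_right_distrib intro: image_eqI[of _ _ "z + y"])
qed

lemma add_mult_diff_in_image_Lam_iff:
  "(L1 + L2) *v x - (L1 + L2) *v y \<in> (*v) L1 ` Lam L1 L2 \<longleftrightarrow> x - y \<in> Gamma1 L1 L2"
  using add_in_image_Lam_iff[of "x - y"]
  by (simp add: matrix_vector_mult_add_rdistrib matrix_vector_mult_diff_distrib algebra_simps)

lemma
  shows finite_cosets_Gamma1: "finite (cosets (Gamma1 L1 L2))"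
    and surj_mod_image_Lam: "\<exists>x. w - (L1 + L2) *v x \<in> (*v) L1 ` Lam L1 L2"
    and card_cosets_Gamma1: "card (cosets (Gamma1 L1 L2)) = card (cosets ((*v) L1 ` Lam L1 L2))"
proof -
  have Gamma1: "full_lattice (Gamma1 L1 L2)"
    unfolding Gamma1_eq using full_lattice_Lam full_lattice_image_Lam
    by (intro full_lattice_Int full_lattice_vimage)
  have "card (cosets ((*v) L1 ` Lam L1 L2)) \<le> card (cosets (Gamma1 L1 L2))"
    using Gamma1_maps_to_image_Lam
    by (intro card_cosets_le_if_coprime_pair[OF coprime Gamma1 full_lattice_image_Lam]) auto
  then show "finite (cosets (Gamma1 L1 L2))"
    and "\<exists>x. w - (L1 + L2) *v x \<in> (*v) L1 ` Lam L1 L2"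
    and "card (cosets (Gamma1 L1 L2)) = card (cosets ((*v) L1 ` Lam L1 L2))"
    using surj_mod_if_card_cosets_le[of "Gamma1 L1 L2" "(*v) L1 ` Lam L1 L2" "(*v) (L1 + L2)"]
      Gamma1 full_lattice_image_Lam finite_cosets_image_Lam add_mult_diff_in_image_Lam_iff
    by (auto simp: full_lattice_def)
qed

end

theorem lemma4p3:
  fixes L1 L2 :: "int ^ 'n ^ 'n" and p q :: nat
  assumes irr: "irreducible_pair L1 L2"
    and cop: "coprime_pair L1 L2"
    and detp: "\<bar>det L1\<bar> = int p" and p_pos: "p > 0"
    and detq: "\<bar>det L2\<bar> = int q" and q_pos: "q > 0"
  defines "\<Lambda> \<equiv> Lam L1 L2"
    and "\<Gamma> \<equiv> Gamma1 L1 L2"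
    and "L1\<Lambda> \<equiv> (\<lambda>y. L1 *v y) ` Lam L1 L2"
  shows "(\<forall>x y. x - y \<in> \<Gamma> \<longrightarrow> L1 *v x - L1 *v y \<in> L1\<Lambda>)
       \<and> (\<forall>x y. x - y \<in> \<Gamma> \<longrightarrow> L2 *v x - L2 *v y \<in> L1\<Lambda>)
       \<and> finite (cosets \<Gamma>) \<and> finite (cosets L1\<Lambda>)
       \<and> (\<forall>x y. (L1 + L2) *v x - (L1 + L2) *v y \<in> L1\<Lambda> \<longleftrightarrow> x - y \<in> \<Gamma>)
       \<and> (\<forall>z. \<exists>x. z - (L1 + L2) *v x \<in> L1\<Lambda>)
       \<and> card (cosets \<Gamma>) = p ^ 2 * q"
proof -
  interpret coprime_int_pair L1 L2
    using cop detp p_pos detq q_pos by unfold_locales auto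
  have "int (card (cosets (Gamma1 L1 L2))) = int (p ^ 2 * q)"
    using card_cosets_Gamma1 card_cosets_image_Lam detp detq by simp
  then have card: "card (cosets (Gamma1 L1 L2)) = p ^ 2 * q"
    by (simp only: of_nat_eq_iff)
  have "L1 *v x - L1 *v y \<in> L1\<Lambda>" "L2 *v x - L2 *v y \<in> L1\<Lambda>" if "x - y \<in> \<Gamma>" for x y
    using Gamma1_maps_to_image_Lam that
    by (simp_all add: \<Gamma>_def L1\<Lambda>_def flip: matrix_vector_mult_diff_distrib)
  then show ?thesis
    using finite_cosets_Gamma1 finite_cosets_image_Lam add_mult_diff_in_image_Lam_iff
      surj_mod_image_Lam card
    by (simp add: \<Gamma>_def L1\<Lambda>_def)
qed

end
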